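(* Let $\|\cdot\|$ be a norm on $\mathbb{R}^d$ and $C_{\|\cdot\|}=\{\mathbf{x}\in\mathbb{R}^d:\|\mathbf{x}\|\ge1\}$. Let $\mathbf{X}$ be an $\mathbb{R}^d$-valued random vector with probability density $f_{\mathbf{X}}$ that is regularly varying with limit $v$, i.e. $f_{\mathbf{X}}(\lambda\mathbf{1})>0$ and $v(\lambda\mathbf{1})>0$ for all $\lambda>0$ and $$\frac{f_{\mathbf{X}}(t\mathbf{x})}{f_{\mathbf{X}}(t\mathbf{1})}\to v(\mathbf{x})\quad\text{as }t\to\infty,\ \text{for all }\mathbf{x}\in\mathbb{R}^d\setminus\{\mathbf{0}\}.$$ Suppose that $v$ is non-null on $C_{\|\cdot\|}$ and that the functions $\mathbf{x}\mapsto f_{\mathbf{X}}(t\mathbf{x})/f_{\mathbf{X}}(t\mathbf{1})$ are dominated on $C_{\|\cdot\|}$, for all sufficiently large $t$, by a single integrable function. Then $$f_{t^{-1}\mathbf{X}\,\mid\,\|\mathbf{X}\|\ge t}\ \to\ f_{\mathbf{Y}}:=\frac{v}{\int_{C_{\|\cdot\|}}v(\tilde{\mathbf{x}})\,d\tilde{\mathbf{x}}}\quad\text{pointwise on }C_{\|\cdot\|}\text{ as }t\to\infty,$$ where $f_{\mathbf{Y}}$ is a probability density on $C_{\|\cdot\|}$, and $\mathbf{X}$ is regularly varying with limiting distribution that of density $f_{\mathbf{Y}}$. In this case, $f_{\mathbf{Y}}$ is homogeneous of order $-\alpha-d$ for some $\alpha>0$: $f_{\mathbf{Y}}(\lambda\mathbf{x})=\lambda^{-\alpha-d}f_{\mathbf{Y}}(\mathbf{x})$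 for all $\lambda\ge1$, $\mathbf{x}\in C_{\|\cdot\|}$.
   Context: $\mathbf{1}=(1,\dots,1)\in\mathbb{R}^d$; densities are with respect to Lebesgue measure, and "non-null" means not equal to zero almost everywhere; $f_{t^{-1}\mathbf{X}\mid\|\mathbf{X}\|\ge t}$ is the conditional density of $t^{-1}\mathbf{X}$ given $\|\mathbf{X}\|\ge t$. A random vector $\mathbf{X}$ in $\mathbb{R}^d$ is regularly varying with limit $\nu$ if $\nu$ is a probability distribution on $C_{\|\cdot\|}$ with $\nu(\lambda C_{\|\cdot\|})>0$ for some $\lambda>1$ and the conditional distribution of $t^{-1}\mathbf{X}$ given $\|\mathbf{X}\|\ge t$ converges weakly to $\nu$ as $t\to\infty$. *)

theory Defs
  imports "HOL-Probability.Probability"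
begin

definition is_norm :: "('a::real_vector \<Rightarrow> real) \<Rightarrow> bool" where
  "is_norm N \<longleftrightarrow>
     (\<forall>x. 0 \<le> N x) \<and>
     (\<forall>x. N x = 0 \<longleftrightarrow> x = 0) \<and>
     (\<forall>c x. N (c *\<^sub>R x) = \<bar>c\<bar> * N x) \<and>
     (\<forall>x y. N (x + y) \<le> N x + N y)"

definition outside_ball :: "('a \<Rightarrow> real) \<Rightarrow> 'a set" where
  "outside_ball N = {x. 1 \<le> N x}"

text \<open>The vector \<open>1\<close> in \<open>real ^ 'n\<close> is the constant vector \<open>(1, \<dots>, 1)\<close>. The value of \<open>v\<close>
  at the origin is irrelevant.\<close>

definition regularly_varying_density :: "(real ^ 'n \<Rightarrow> real) \<Rightarrow> (real ^ 'n \<Rightarrow> real) \<Rightarrow> bool" where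
  "regularly_varying_density f v \<longleftrightarrow>
     (\<forall>l>0. f (l *\<^sub>R 1) > 0 \<and> v (l *\<^sub>R 1) > 0) \<and>
     (\<forall>x. x \<noteq> 0 \<longrightarrow> ((\<lambda>t. f (t *\<^sub>R x) / f (t *\<^sub>R 1)) \<longlongrightarrow> v x) at_top)"

definition exceedance :: "'w measure \<Rightarrow> ('w \<Rightarrow> 'a) \<Rightarrow> ('a \<Rightarrow> real) \<Rightarrow> real \<Rightarrow> 'w set" where
  "exceedance M X N t = {\<omega> \<in> space M. t \<le> N (X \<omega>)}"

text \<open>\<open>uniform_measure M A\<close> is the conditional probability \<open>M (\<cdot> | A)\<close>.\<close>

definition conditional_law ::
  "'w measure \<Rightarrow> ('w \<Rightarrow> 'a::euclidean_space) \<Rightarrow> ('a \<Rightarrow> real) \<Rightarrow> real \<Rightarrow> 'a measure" where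
  "conditional_law M X N t =
     distr (uniform_measure M (exceedance M X N t)) borel (\<lambda>\<omega>. X \<omega> /\<^sub>R t)"

text \<open>By the change of variables \<open>y = t x\<close>, \<open>t\<^sup>d f (t x)\<close> is the density of \<open>X / t\<close>, and the
  conditioning event is \<open>X / t \<in> outside_ball N\<close>. Pointwise convergence of densities refers to
  this version of the conditional density.\<close>

definition conditional_density ::
  "'w measure \<Rightarrow> ('w \<Rightarrow> 'a) \<Rightarrow> ('a::euclidean_space \<Rightarrow> real) \<Rightarrow> ('a \<Rightarrow> real) \<Rightarrow> real \<Rightarrow> 'a \<Rightarrow> real" where
  "conditional_density M X f N t x =
     (if x \<in> outside_ball N
      then t ^ DIM('a) * f (t *\<^sub>R x) / measure M (exceedance M X N t)
      else 0)"

text \<open>Weak convergence, along a filter, of measures regarded as measures on the topological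
  subspace \<open>S\<close>; the library's \<open>weak_conv_m\<close> only covers sequences of measures on the real line.\<close>

definition weak_conv_on ::
  "'a::topological_space set \<Rightarrow> ('i \<Rightarrow> 'a measure) \<Rightarrow> 'a measure \<Rightarrow> 'i filter \<Rightarrow> bool" where
  "weak_conv_on S \<mu> \<nu> F \<longleftrightarrow>
     (\<forall>h :: 'a \<Rightarrow> real. continuous_on S h \<and> bounded (h ` S) \<longrightarrow>
        ((\<lambda>i. LINT x:S|\<mu> i. h x) \<longlongrightarrow> (LINT x:S|\<nu>. h x)) F)"

definition regularly_varying ::
  "'w measure \<Rightarrow> ('w \<Rightarrow> 'a::euclidean_space) \<Rightarrow> ('a \<Rightarrow> real) \<Rightarrow> 'a measure \<Rightarrow> bool" where
  "regularly_varying M X N \<nu> \<longleftrightarrow>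
     X \<in> borel_measurable M \<and>
     prob_space \<nu> \<and> sets \<nu> = sets borel \<and> measure \<nu> (outside_ball N) = 1 \<and>
     (\<exists>l>1. measure \<nu> ((\<lambda>x. l *\<^sub>R x) ` outside_ball N) > 0) \<and>
     weak_conv_on (outside_ball N) (conditional_law M X N) \<nu> at_top"

definition prob_density_on :: "'a::euclidean_space set \<Rightarrow> ('a \<Rightarrow> real) \<Rightarrow> bool" where
  "prob_density_on S f \<longleftrightarrow>
     set_borel_measurable lborel S f \<and> (\<forall>x\<in>S. 0 \<le> f x) \<and>
     (\<integral>\<^sup>+x\<in>S. ennreal (f x) \<partial>lborel) = 1"

definition law_of_density_on :: "'a::euclidean_space set \<Rightarrow> ('a \<Rightarrow> real) \<Rightarrow> 'a measure" where
  "law_of_density_on S f = density lborel (\<lambda>x. ennreal (f x) * indicator S x)"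

end

(* The change of variables y = t x turns P(N X >= t) / (t^d f(t 1)) into the integral of
   f(t x) / f(t 1) over the outside of the ball. Dominated convergence sends this, also when weighted by a
   bounded continuous function, to the corresponding integral of v; this yields the pointwise and
   the weak limit. The limit satisfies v(l x) = v(l 1) v(x), so m(l) = l^d v(l 1) is multiplicative,
   and m(l) is the fraction of the mass of v lying in {N >= l}. Hence m <= 1 for l >= 1, which
   forces m(l) = l^(-alpha) with alpha >= 0 without any appeal to Karamata theory, and alpha = 0 is
   impossible because the tail mass vanishes as l grows. *)

theory Submission
  imports Defs
begin

section \<open>Topology and measurability of an abstract norm\<close>

text \<open>The triangle inequality and homogeneity make \<open>N\<close> convex, and a convex
  function on a finite-dimensional space is continuous. This is the source of all measurability of
  \<open>N\<close> and of \<open>outside_ball N\<close>.\<close>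

lemma is_norm_continuous:
  fixes N :: "'a::euclidean_space \<Rightarrow> real"
  assumes "is_norm N"
  shows "continuous_on UNIV N"
proof (rule convex_on_continuous)
  show "convex_on UNIV N"
  proof (rule convex_onI)
    fix t :: real and x y :: 'a
    assume t: "0 < t" "t < 1"
    have "N ((1 - t) *\<^sub>R x + t *\<^sub>R y) \<le> N ((1 - t) *\<^sub>R x) + N (t *\<^sub>R y)"
      using assms unfolding is_norm_def by blast
    also have "\<dots> = (1 - t) * N x + t * N y"
      using assms t by (simp add: is_norm_def)
    finally show "N ((1 - t) *\<^sub>R x + t *\<^sub>R y) \<le> (1 - t) * N x + t * N y" .
  qed simp
qed simp

lemma is_norm_borel:
  fixes N :: "'a::euclidean_space \<Rightarrow> real"
  assumes "is_norm N"
  shows "N \<in> borel_measurable borel"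
  using is_norm_continuous[OF assms] by (rule borel_measurable_continuous_onI)

lemma is_norm_scaleR:
  assumes "is_norm N" "0 < t"
  shows "N (t *\<^sub>R x) = t * N x"
  using assms by (simp add: is_norm_def)

lemma outside_ball_nonzero:
  assumes "is_norm N" "x \<in> outside_ball N"
  shows "x \<noteq> 0"
  using assms unfolding is_norm_def outside_ball_def
  by (metis mem_Collect_eq not_one_le_zero)

lemma outside_ball_borel:
  fixes N :: "'a::euclidean_space \<Rightarrow> real"
  assumes "is_norm N"
  shows "outside_ball N \<in> sets borel"
proof -
  note [measurable] = is_norm_borel[OF assms]
  show ?thesis unfolding outside_ball_def by measurable
qed

lemma scaleR_image_outside_ball:
  assumes "is_norm N" "0 < l"
  shows "(\<lambda>x. l *\<^sub>R x) ` outside_ball N = {x. l \<le> N x}"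
proof (intro set_eqI iffI)
  fix x assume "x \<in> {x. l \<le> N x}"
  moreover have "N x = l * N (x /\<^sub>R l)"
    using is_norm_scaleR[OF assms, of "x /\<^sub>R l"] assms by simp
  ultimately have "x /\<^sub>R l \<in> outside_ball N" using assms by (simp add: outside_ball_def)
  then show "x \<in> (\<lambda>x. l *\<^sub>R x) ` outside_ball N"
    using assms by (intro image_eqI[of _ _ "x /\<^sub>R l"]) auto
qed (use assms in \<open>auto simp: outside_ball_def is_norm_scaleR\<close>)

section \<open>Change of variables and the conditional density\<close>

lemma nn_integral_lborel_scaleR:
  fixes F :: "'a::euclidean_space \<Rightarrow> ennreal"
  assumes [measurable]: "F \<in> borel_measurable borel" and c: "0 < c"
  shows "(\<integral>\<^sup>+x. F x \<partial>lborel) = ennreal (c ^ DIM('a)) * (\<integral>\<^sup>+x. F (c *\<^sub>R x) \<partial>lborel)"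
proof -
  have "(\<integral>\<^sup>+x. F x \<partial>lborel) =
      (\<integral>\<^sup>+x. F x \<partial>density (distr lborel borel (\<lambda>x::'a. 0 + c *\<^sub>R x)) (\<lambda>_. ennreal (\<bar>c\<bar> ^ DIM('a))))"
    using lborel_affine[of c "0::'a"] c by simp
  also have "\<dots> = ennreal (c ^ DIM('a)) * (\<integral>\<^sup>+x. F (c *\<^sub>R x) \<partial>lborel)"
    using c by (simp add: nn_integral_density nn_integral_distr nn_integral_cmult)
  finally show ?thesis .
qed

lemma integral_lborel_scaleR:
  fixes F :: "'a::euclidean_space \<Rightarrow> real"
  assumes [measurable]: "F \<in> borel_measurable borel" and c: "0 < c"
  shows "(LINT x|lborel. F x) = c ^ DIM('a) * (LINT x|lborel. F (c *\<^sub>R x))"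
proof -
  have "(LINT x|lborel. F x) =
      (LINT x|density (distr lborel borel (\<lambda>x::'a. 0 + c *\<^sub>R x)) (\<lambda>_. ennreal (\<bar>c\<bar> ^ DIM('a))). F x)"
    using lborel_affine[of c "0::'a"] c by simp
  also have "\<dots> = c ^ DIM('a) * (LINT x|lborel. F (c *\<^sub>R x))"
    using c by (simp add: integral_density integral_distr)
  finally show ?thesis .
qed

text \<open>The density integral of \<open>X\<close> is rescaled by \<open>t\<close>. A general
  \<open>B\<close> serves both uses: it determines the whole conditional law, and
  \<open>B = UNIV\<close> gives the tail probability.\<close>

lemma emeasure_exceedance_scaled:
  fixes X :: "'w \<Rightarrow> 'a::euclidean_space"
  assumes N: "is_norm N"
    and X: "distributed M lborel X (\<lambda>x. ennreal (f x))"
    and t: "0 < t" and B[measurable]: "B \<in> sets borel"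
  shows "emeasure M (exceedance M X N t \<inter> {\<omega> \<in> space M. X \<omega> /\<^sub>R t \<in> B}) =
    (\<integral>\<^sup>+x. ennreal (t ^ DIM('a)) * ennreal (f (t *\<^sub>R x)) * indicator (outside_ball N \<inter> B) x \<partial>lborel)"
proof -
  note [measurable] = is_norm_borel[OF N] outside_ball_borel[OF N]
  have [measurable]: "X \<in> borel_measurable M" "(\<lambda>x. ennreal (f x)) \<in> borel_measurable borel"
    using X by (auto simp: distributed_def)
  \<comment> \<open>The event in terms of the value of \<open>X\<close>; its preimage under scaling
    by \<open>t\<close> is \<open>outside_ball N \<inter> B\<close>.\<close>
  define A where "A = {x. t \<le> N x \<and> x /\<^sub>R t \<in> B}"
  have A[measurable]: "A \<in> sets borel" unfolding A_def by measurable
  have "exceedance M X N t \<inter> {\<omega> \<in> space M. X \<omega> /\<^sub>R t \<in> B} = X -` A \<inter> space M"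
    by (auto simp: exceedance_def A_def)
  then have "emeasure M (exceedance M X N t \<inter> {\<omega> \<in> space M. X \<omega> /\<^sub>R t \<in> B}) =
      (\<integral>\<^sup>+x. ennreal (f x) * indicator A x \<partial>lborel)"
    using distributed_emeasure[OF X, of A] by simp
  also have "\<dots> = ennreal (t ^ DIM('a)) *
      (\<integral>\<^sup>+x. ennreal (f (t *\<^sub>R x)) * indicator A (t *\<^sub>R x) \<partial>lborel)"
    using t by (intro nn_integral_lborel_scaleR) measurable
  also have "\<dots> = (\<integral>\<^sup>+x. ennreal (t ^ DIM('a)) * (ennreal (f (t *\<^sub>R x)) * indicator A (t *\<^sub>R x)) \<partial>lborel)"
    by (rule nn_integral_cmult[symmetric]) measurable
  also have "\<dots> = (\<integral>\<^sup>+x. ennreal (t ^ DIM('a)) * ennreal (f (t *\<^sub>R x)) * indicator (outside_ball N \<inter> B) x \<partial>lborel)"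
    using t by (intro nn_integral_cong)
      (auto simp: A_def outside_ball_def is_norm_scaleR[OF N] indicator_def mult.assoc)
  finally show ?thesis .
qed

text \<open>\<open>distributed\<close> only gives measurability after \<open>ennreal\<close>, which
  cuts negative values to 0; for nonnegative \<open>f\<close> nothing is lost and
  \<open>enn2real\<close> undoes it.\<close>

lemma measurable_of_ennreal:
  assumes "(\<lambda>x. ennreal (f x)) \<in> borel_measurable M" "\<And>x. 0 \<le> f x"
  shows "f \<in> borel_measurable M"
proof -
  have "(\<lambda>x. enn2real (ennreal (f x))) \<in> borel_measurable M"
    using assms(1) by measurable
  then show ?thesis using assms(2) by simp
qed

lemma conditional_density_nonneg:
  assumes "\<And>x. 0 \<le> f x" "0 < t"
  shows "0 \<le> conditional_density M X f N t x"
  using assms by (simp add: conditional_density_def)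

lemma conditional_density_measurable:
  fixes f :: "'a::euclidean_space \<Rightarrow> real"
  assumes N: "is_norm N" and [measurable]: "f \<in> borel_measurable borel"
  shows "conditional_density M X f N t \<in> borel_measurable borel"
proof -
  note [measurable] = outside_ball_borel[OF N]
  show ?thesis unfolding conditional_density_def[abs_def] by measurable
qed

text \<open>Justifies the explicit formula \<open>conditional_density\<close>: both measures agree
  on every Borel set, by the scaled integral divided by the positive probability of the
  exceedance.\<close>

lemma distributed_conditional_density:
  fixes X :: "'w \<Rightarrow> 'a::euclidean_space"
  assumes N: "is_norm N" and M: "prob_space M" and nonneg: "\<And>x. 0 \<le> f x"
    and X: "distributed M lborel X (\<lambda>x. ennreal (f x))"
    and t: "0 < t" and pos: "0 < measure M (exceedance M X N t)"
  shows "distributed (uniform_measure M (exceedance M X N t)) lborel (\<lambda>\<omega>. X \<omega> /\<^sub>R t)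
           (\<lambda>x. ennreal (conditional_density M X f N t x))"
proof -
  interpret prob_space M by fact
  note [measurable] = is_norm_borel[OF N] outside_ball_borel[OF N]
  have [measurable]: "X \<in> borel_measurable M" "(\<lambda>x. ennreal (f x)) \<in> borel_measurable borel"
    using X by (auto simp: distributed_def)
  have f[measurable]: "f \<in> borel_measurable borel"
    using nonneg by (rule measurable_of_ennreal[rotated]) measurable
  note [measurable] = conditional_density_measurable[OF N f]
  let ?E = "exceedance M X N t"
  have E[measurable]: "?E \<in> sets M" unfolding exceedance_def by measurable
  have "distr (uniform_measure M ?E) lborel (\<lambda>\<omega>. X \<omega> /\<^sub>R t) =
      density lborel (\<lambda>x. ennreal (conditional_density M X f N t x))"
  proof (rule measure_eqI)
    fix B assume "B \<in> sets (distr (uniform_measure M ?E) lborel (\<lambda>\<omega>. X \<omega> /\<^sub>R t))"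
    then have B[measurable]: "B \<in> sets borel" by simp
    have "emeasure (distr (uniform_measure M ?E) lborel (\<lambda>\<omega>. X \<omega> /\<^sub>R t)) B =
        emeasure (uniform_measure M ?E) {\<omega> \<in> space M. X \<omega> /\<^sub>R t \<in> B}"
      by (subst emeasure_distr) (simp_all add: vimage_def Int_def conj_commute)
    also have "\<dots> = emeasure M (?E \<inter> {\<omega> \<in> space M. X \<omega> /\<^sub>R t \<in> B}) / emeasure M ?E"
      by (rule emeasure_uniform_measure) measurable
    also have "\<dots> = (\<integral>\<^sup>+x. ennreal (t ^ DIM('a)) * ennreal (f (t *\<^sub>R x)) *
        indicator (outside_ball N \<inter> B) x \<partial>lborel) / ennreal (measure M ?E)"
      by (simp only: emeasure_exceedance_scaled[OF N X t B] emeasure_eq_measure[of ?E])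
    also have "\<dots> = (\<integral>\<^sup>+x. ennreal (t ^ DIM('a)) * ennreal (f (t *\<^sub>R x)) *
        indicator (outside_ball N \<inter> B) x / ennreal (measure M ?E) \<partial>lborel)"
      by (rule nn_integral_divide[symmetric]) measurable
    also have "\<dots> = (\<integral>\<^sup>+x. ennreal (conditional_density M X f N t x) * indicator B x \<partial>lborel)"
      using t pos nonneg
      by (intro nn_integral_cong)
        (auto simp: conditional_density_def indicator_def divide_ennreal ennreal_mult[symmetric])
    also have "\<dots> = emeasure (density lborel (\<lambda>x. ennreal (conditional_density M X f N t x))) B"
      by (simp add: emeasure_density)
    finally show "emeasure (distr (uniform_measure M ?E) lborel (\<lambda>\<omega>. X \<omega> /\<^sub>R t)) B =
        emeasure (density lborel (\<lambda>x. ennreal (conditional_density M X f N t x))) B" .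
  qed simp
  then show ?thesis by (simp add: distributed_def)
qed

text \<open>Converts the case \<open>B = UNIV\<close> to a Bochner integral. For a nonnegative
  measurable integrand that integral is \<open>enn2real\<close> of the nonnegative one, so
  integrability is not a separate concern.\<close>

lemma measure_exceedance:
  fixes X :: "'w \<Rightarrow> 'a::euclidean_space"
  assumes N: "is_norm N" and M: "prob_space M" and nonneg: "\<And>x. 0 \<le> f x"
    and X: "distributed M lborel X (\<lambda>x. ennreal (f x))"
    and t: "0 < t"
  shows "measure M (exceedance M X N t) =
    t ^ DIM('a) * (LINT x|lborel. indicator (outside_ball N) x * f (t *\<^sub>R x))"
proof -
  interpret prob_space M by fact
  note [measurable] = outside_ball_borel[OF N]
  have [measurable]: "f \<in> borel_measurable borel"
    using nonneg X by (intro measurable_of_ennreal) (auto simp: distributed_def)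
  have "exceedance M X N t \<inter> {\<omega> \<in> space M. X \<omega> /\<^sub>R t \<in> UNIV} = exceedance M X N t"
    by (auto simp: exceedance_def)
  then have "ennreal (measure M (exceedance M X N t)) =
      (\<integral>\<^sup>+x. ennreal (t ^ DIM('a)) * ennreal (f (t *\<^sub>R x)) * indicator (outside_ball N) x \<partial>lborel)"
    using emeasure_exceedance_scaled[OF N X t, of UNIV] by (simp add: emeasure_eq_measure)
  also have "\<dots> = (\<integral>\<^sup>+x. ennreal (t ^ DIM('a) * (indicator (outside_ball N) x * f (t *\<^sub>R x))) \<partial>lborel)"
    using t nonneg by (intro nn_integral_cong) (auto simp: indicator_def ennreal_mult)
  finally have "measure M (exceedance M X N t) =
      (LINT x|lborel. t ^ DIM('a) * (indicator (outside_ball N) x * f (t *\<^sub>R x)))"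
    using t nonneg by (subst integral_eq_nn_integral) (auto dest: arg_cong[where f = enn2real])
  then show ?thesis by simp
qed

section \<open>Cauchy's functional equation on a half line\<close>

text \<open>Nonnegativity turns additivity into monotonicity, and a monotone solution is squeezed
  between its values at integers.\<close>

lemma additive_nonneg_imp_linear:
  fixes a :: "real \<Rightarrow> real"
  assumes add: "\<And>r s. 0 \<le> r \<Longrightarrow> 0 \<le> s \<Longrightarrow> a (r + s) = a r + a s"
    and nonneg: "\<And>s. 0 \<le> s \<Longrightarrow> 0 \<le> a s"
    and s: "0 \<le> s"
  shows "a s = s * a 1"
proof -
  have a_nat: "a (real n * r) = real n * a r" if "0 \<le> r" for n r
  proof (induction n)
    case 0 then show ?case using add[of 0 0] by simp
  next
    case (Suc n)
    have "a (real (Suc n) * r) = a (real n * r + r)" by (simp add: algebra_simps)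
    also have "\<dots> = a (real n * r) + a r" using that by (intro add) auto
    finally show ?case using Suc by (simp add: algebra_simps)
  qed
  have mono: "a r \<le> a s" if "0 \<le> r" "r \<le> s" for r s
    using add[of r "s - r"] nonneg[of "s - r"] that by simp
  \<comment> \<open>With \<open>m\<close> the floor of \<open>n * s\<close>, both
    \<open>n * a s\<close> and \<open>n * s * a 1\<close> lie between \<open>m * a 1\<close> and
    \<open>(m + 1) * a 1\<close>. The bound does not depend on \<open>n\<close>, so the difference
    must vanish.\<close>
  have bound: "real n * \<bar>a s - s * a 1\<bar> \<le> a 1" for n
  proof -
    define m where "m = nat \<lfloor>real n * s\<rfloor>"
    have m: "real m \<le> real n * s" "real n * s \<le> real m + 1"
      using s unfolding m_def by (auto simp: of_nat_nat)
    have am: "a (real m) = real m * a 1" "a (real m + 1) = (real m + 1) * a 1"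
      using a_nat[of 1 m] a_nat[of 1 "Suc m"] by (simp_all add: add.commute)
    have 1: "real m * a 1 \<le> real n * a s" "real n * a s \<le> (real m + 1) * a 1"
      using mono[OF _ m(1)] mono[OF _ m(2)] s a_nat[OF s, of n] am by auto
    have 2: "real m * a 1 \<le> real n * s * a 1" "real n * s * a 1 \<le> (real m + 1) * a 1"
      using m nonneg[of 1] by (auto intro!: mult_right_mono)
    have "\<bar>real n * a s - real n * s * a 1\<bar> \<le> a 1"
      using 1 2 by (simp add: algebra_simps abs_le_iff)
    moreover have "real n * a s - real n * s * a 1 = real n * (a s - s * a 1)"
      by (simp add: algebra_simps)
    ultimately show ?thesis by (simp add: abs_mult)
  qed
  show ?thesis
  proof (rule ccontr)
    assume "a s \<noteq> s * a 1"
    then obtain n where "a 1 < real n * \<bar>a s - s * a 1\<bar>"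
      using reals_Archimedean3[of "\<bar>a s - s * a 1\<bar>"] by auto
    with bound[of n] show False by simp
  qed
qed

text \<open>Passing to logarithms on both sides gives Cauchy's equation; the bound
  \<open>m s \<le> 1\<close> supplies the sign condition that excludes irregular solutions.\<close>

lemma multiplicative_le_1_imp_powr:
  fixes m :: "real \<Rightarrow> real"
  assumes mult: "\<And>r s. 1 \<le> r \<Longrightarrow> 1 \<le> s \<Longrightarrow> m (r * s) = m r * m s"
    and pos: "\<And>s. 1 \<le> s \<Longrightarrow> 0 < m s" and le: "\<And>s. 1 \<le> s \<Longrightarrow> m s \<le> 1"
  obtains \<alpha> where "0 \<le> \<alpha>" "\<And>s. 1 \<le> s \<Longrightarrow> m s = s powr (- \<alpha>)"
proof -
  \<comment> \<open>The exponent will be \<open>a 1\<close>, that is, minus the logarithm of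
    \<open>m\<close> at Euler's number.\<close>
  define a where "a s = - ln (m (exp s))" for s
  have a_nonneg: "0 \<le> a s" if "0 \<le> s" for s
    using le[of "exp s"] pos[of "exp s"] that by (simp add: a_def)
  have a_lin: "a s = s * a 1" if "0 \<le> s" for s
    using _ a_nonneg that
  proof (rule additive_nonneg_imp_linear)
    fix r s :: real assume "0 \<le> r" "0 \<le> s"
    then show "a (r + s) = a r + a s"
      using pos[of "exp r"] pos[of "exp s"] by (simp add: a_def exp_add mult ln_mult)
  qed
  show thesis
  proof (rule that)
    show "0 \<le> a 1" by (rule a_nonneg) simp
    fix s :: real assume s: "1 \<le> s"
    have "ln (m s) = - (ln s * a 1)"
      using a_lin[of "ln s"] s by (simp add: a_def)
    then have "m s = exp (- (ln s * a 1))"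
      using pos[OF s] by (metis exp_ln)
    then show "m s = s powr (- a 1)" using s by (simp add: powr_def mult.commute)
  qed
qed

text \<open>The dominating function is only Lebesgue measurable; \<open>w\<close> is a Borel version of it, which allows
  all the integrals to be taken with respect to \<open>lborel\<close>.\<close>

locale dominated_density =
  fixes N f v w :: "real ^ 'n \<Rightarrow> real"
  assumes norm: "is_norm N"
    and f_borel[measurable]: "f \<in> borel_measurable borel"
    and f_nonneg: "\<And>x. 0 \<le> f x"
    and rv: "regularly_varying_density f v"
    and w: "integrable lborel w"
    and dominated: "\<forall>\<^sub>F t in at_top. AE x in lborel.
          \<bar>indicator (outside_ball N) x * (f (t *\<^sub>R x) / f (t *\<^sub>R 1))\<bar> \<le> w x"
    and nonnull: "\<not> (AE x in lborel. x \<in> outside_ball N \<longrightarrow> v x = 0)"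
begin

abbreviation mass :: real where
  "mass \<equiv> LINT x|lborel. indicator (outside_ball N) x * v x"

section \<open>Regularity of the limit and dominated convergence\<close>

lemma C_borel[measurable]: "outside_ball N \<in> sets borel"
  by (rule outside_ball_borel[OF norm])

lemma N_borel[measurable]: "N \<in> borel_measurable borel"
  by (rule is_norm_borel[OF norm])

lemma ratio_tendsto: "x \<noteq> 0 \<Longrightarrow> ((\<lambda>t. f (t *\<^sub>R x) / f (t *\<^sub>R 1)) \<longlongrightarrow> v x) at_top"
  using rv by (simp add: regularly_varying_density_def)

lemma f_diagonal_pos: "0 < t \<Longrightarrow> 0 < f (t *\<^sub>R 1)"
  using rv by (simp add: regularly_varying_density_def)

lemma v_diagonal_pos: "0 < t \<Longrightarrow> 0 < v (t *\<^sub>R 1)"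
  using rv by (simp add: regularly_varying_density_def)

lemma v_nonneg: "x \<noteq> 0 \<Longrightarrow> 0 \<le> v x"
  by (rule tendsto_lowerbound[OF ratio_tendsto]) (auto simp: f_nonneg)

lemma v_nonneg_outside: "0 \<le> indicator (outside_ball N) x * v x"
  using v_nonneg outside_ball_nonzero[OF norm] by (auto simp: indicator_def)

lemma v_borel[measurable]: "v \<in> borel_measurable borel"
proof (rule borel_measurable_LIMSEQ_real)
  fix x :: "real ^ 'n"
  \<comment> \<open>Measurability of \<open>v\<close> comes from the limit along integer
    \<open>t\<close>. At the origin no convergence is assumed, so the sequence is made constant
    there.\<close>
  show "(\<lambda>i. if x = 0 then v 0 else f (real i *\<^sub>R x) / f (real i *\<^sub>R 1)) \<longlonglongrightarrow> v x"
    using filterlim_compose[OF ratio_tendsto filterlim_real_sequentially, of x]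
    by (cases "x = 0") auto
qed measurable

text \<open>Dominated convergence with a bounded weight: \<open>h = 1\<close> yields the normalising
  constant, a test function \<open>h\<close> yields weak convergence. Measurability is asked of the
  product with the indicator because test functions are only controlled on
  \<open>outside_ball N\<close>.\<close>

lemma
  assumes h[measurable]: "(\<lambda>x. indicator (outside_ball N) x * h x) \<in> borel_measurable borel"
    and bounded: "\<And>x. x \<in> outside_ball N \<Longrightarrow> \<bar>h x\<bar> \<le> B"
  shows integral_ratio_tendsto:
      "((\<lambda>t. LINT x|lborel. indicator (outside_ball N) x * h x * (f (t *\<^sub>R x) / f (t *\<^sub>R 1)))
        \<longlongrightarrow> (LINT x|lborel. indicator (outside_ball N) x * h x * v x)) at_top" (is ?lim)
    and integrable_bounded_times_v:
      "integrable lborel (\<lambda>x. indicator (outside_ball N) x * h x * v x)" (is ?int)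
proof -
  have lim: "AE x in lborel. ((\<lambda>t. indicator (outside_ball N) x * h x * (f (t *\<^sub>R x) / f (t *\<^sub>R 1)))
      \<longlongrightarrow> indicator (outside_ball N) x * h x * v x) at_top"
  proof (rule AE_I2)
    fix x
    show "((\<lambda>t. indicator (outside_ball N) x * h x * (f (t *\<^sub>R x) / f (t *\<^sub>R 1)))
      \<longlongrightarrow> indicator (outside_ball N) x * h x * v x) at_top"
      using outside_ball_nonzero[OF norm, of x]
      by (cases "x \<in> outside_ball N") (auto intro!: tendsto_mult ratio_tendsto simp del: times_divide_eq_right)
  qed
  \<comment> \<open>The absolute value of \<open>B\<close> keeps the bound valid off
    \<open>outside_ball N\<close>, where the assumption on \<open>B\<close> says nothing.\<close>
  have bd: "\<forall>\<^sub>F t in at_top. AE x in lborel.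
      norm (indicator (outside_ball N) x * h x * (f (t *\<^sub>R x) / f (t *\<^sub>R 1))) \<le> \<bar>B\<bar> * w x"
    using dominated
  proof eventually_elim
    case (elim t)
    then show ?case
    proof eventually_elim
      case (elim x)
      let ?r = "f (t *\<^sub>R x) / f (t *\<^sub>R 1)"
      \<comment> \<open>The indicator is idempotent, so each factor receives its own copy.\<close>
      have "norm (indicator (outside_ball N) x * h x * ?r) =
          (indicator (outside_ball N) x * \<bar>h x\<bar>) * \<bar>indicator (outside_ball N) x * ?r\<bar>"
        by (auto simp: indicator_def abs_mult)
      also have "\<dots> \<le> \<bar>B\<bar> * w x"
        using elim bounded[of x] by (intro mult_mono) (auto simp: indicator_def)
      finally show ?case .
    qed
  qed
  have int: "integrable lborel (\<lambda>x. \<bar>B\<bar> * w x)" using w by simp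
  show ?lim
    by (rule integral_dominated_convergence_at_top[OF _ _ int lim bd]) measurable
  show ?int
    by (rule integrable_dominated_convergence_at_top[OF _ _ int lim bd]) measurable
qed

lemma integrable_v: "integrable lborel (\<lambda>x. indicator (outside_ball N) x * v x)"
  using integrable_bounded_times_v[of "\<lambda>_. 1" 1] by simp

text \<open>A nonnegative function with integral zero vanishes almost everywhere, against
  \<open>nonnull\<close>.\<close>

lemma mass_pos: "0 < mass"
proof -
  have "mass \<noteq> 0"
  proof
    assume "mass = 0"
    then have "AE x in lborel. indicator (outside_ball N) x * v x = 0"
      by (subst (asm) integral_nonneg_eq_0_iff_AE)
        (use integrable_v v_nonneg_outside in auto)
    then have "AE x in lborel. x \<in> outside_ball N \<longrightarrow> v x = 0"
      by eventually_elim (auto simp: indicator_def)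
    with nonnull show False by simp
  qed
  moreover have "0 \<le> mass" using v_nonneg_outside by (intro Bochner_Integration.integral_nonneg)
  ultimately show ?thesis by simp
qed

section \<open>Homogeneity and the tail index\<close>

text \<open>Insert \<open>f ((t * l) *\<^sub>R 1)\<close> between numerator and denominator: one
  factor is the ratio at \<open>x\<close> along the parameter \<open>t * l\<close>, the other is the
  ratio at \<open>l *\<^sub>R 1\<close>. Limits are unique.\<close>

lemma v_scaleR:
  assumes l: "0 < l" and x: "x \<noteq> 0"
  shows "v (l *\<^sub>R x) = v (l *\<^sub>R 1) * v x"
proof -
  have lt: "filterlim (\<lambda>t. t * l) at_top at_top"
    using l by (intro filterlim_at_top_mult_tendsto_pos[OF tendsto_const]) (auto simp: filterlim_ident mult.commute)
  have "((\<lambda>t. f ((t * l) *\<^sub>R x) / f ((t * l) *\<^sub>R 1) * (f (t *\<^sub>R (l *\<^sub>R 1)) / f (t *\<^sub>R 1)))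
      \<longlongrightarrow> v x * v (l *\<^sub>R 1)) at_top"
    using l by (intro tendsto_mult filterlim_compose[OF ratio_tendsto[OF x] lt] ratio_tendsto) auto
  moreover have "\<forall>\<^sub>F t in at_top. f ((t * l) *\<^sub>R x) / f ((t * l) *\<^sub>R 1) * (f (t *\<^sub>R (l *\<^sub>R 1)) / f (t *\<^sub>R 1))
      = f (t *\<^sub>R (l *\<^sub>R x)) / f (t *\<^sub>R 1)"
    using eventually_gt_at_top[of 0]
  proof eventually_elim
    case (elim t)
    then have "f ((t * l) *\<^sub>R 1) \<noteq> 0" using f_diagonal_pos[of "t * l"] l by auto
    then show ?case by simp
  qed
  ultimately have "((\<lambda>t. f (t *\<^sub>R (l *\<^sub>R x)) / f (t *\<^sub>R 1)) \<longlongrightarrow> v x * v (l *\<^sub>R 1)) at_top"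
    by (rule Lim_transform_eventually)
  moreover have "((\<lambda>t. f (t *\<^sub>R (l *\<^sub>R x)) / f (t *\<^sub>R 1)) \<longlongrightarrow> v (l *\<^sub>R x)) at_top"
    using l x by (intro ratio_tendsto) auto
  ultimately have "v (l *\<^sub>R x) = v x * v (l *\<^sub>R 1)"
    by (intro tendsto_unique[OF trivial_limit_at_top_linorder])
  then show ?thesis by (simp add: mult.commute)
qed

text \<open>Scaling by \<open>l\<close> carries \<open>outside_ball N\<close> onto the tail; the
  Jacobian and \<open>v_scaleR\<close> produce the two factors. The origin, where
  \<open>v_scaleR\<close> is silent, lies in neither set.\<close>

lemma tail_mass:
  assumes l: "0 < l"
  shows "(LINT x|lborel. indicator {x. l \<le> N x} x * v x) = l ^ CARD('n) * v (l *\<^sub>R 1) * mass"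
proof -
  have "(LINT x|lborel. indicator {x. l \<le> N x} x * v x) =
      l ^ CARD('n) * (LINT x|lborel. indicator {x. l \<le> N x} (l *\<^sub>R x) * v (l *\<^sub>R x))"
    using integral_lborel_scaleR[OF _ l, of "\<lambda>x. indicator {x. l \<le> N x} x * v x"] by simp
  also have "(\<lambda>x. indicator {x. l \<le> N x} (l *\<^sub>R x) * v (l *\<^sub>R x)) =
      (\<lambda>x. v (l *\<^sub>R 1) * (indicator (outside_ball N) x * v x))"
  proof
    fix x
    show "indicator {x. l \<le> N x} (l *\<^sub>R x) * v (l *\<^sub>R x) =
        v (l *\<^sub>R 1) * (indicator (outside_ball N) x * v x)"
      using l outside_ball_nonzero[OF norm, of x] v_scaleR[OF l, of x]
      by (auto simp: indicator_def outside_ball_def is_norm_scaleR[OF norm])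
  qed
  finally show ?thesis by simp
qed

lemma tail_subset:
  assumes "1 \<le> l"
  shows "indicator {x. l \<le> N x} x * v x = indicator (outside_ball N) x * indicator {x. l \<le> N x} x * v x"
  using assms by (auto simp: indicator_def outside_ball_def)

lemma tail_integrable:
  assumes "1 \<le> l"
  shows "integrable lborel (\<lambda>x. indicator {x. l \<le> N x} x * v x)"
  unfolding tail_subset[OF assms]
  by (rule integrable_bounded_times_v[where B = 1]) (auto simp: indicator_def)

lemma tail_mass_tendsto_0:
  "(\<lambda>n. LINT x|lborel. indicator {x. real (Suc n) \<le> N x} x * v x) \<longlonglongrightarrow> 0"
proof -
  have "(\<lambda>n. LINT x|lborel. indicator {x. real (Suc n) \<le> N x} x * v x) \<longlonglongrightarrow> (LINT x::real^'n|lborel. 0)"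
  proof (rule integral_dominated_convergence[OF _ _ integrable_v])
    show "AE x in lborel. (\<lambda>n. indicator {x. real (Suc n) \<le> N x} x * v x) \<longlonglongrightarrow> 0"
    proof (rule AE_I2)
      fix x
      obtain k where k: "N x < real k" using reals_Archimedean2 by blast
      \<comment> \<open>Each point leaves the shrinking tails for good once \<open>n\<close> reaches
        \<open>k\<close>. The shift to \<open>Suc n\<close> keeps every threshold at least 1, so
        that \<open>v\<close> on \<open>outside_ball N\<close> dominates.\<close>
      have "\<forall>\<^sub>F n in sequentially. indicator {x. real (Suc n) \<le> N x} x * v x = 0"
        using eventually_ge_at_top[of k] by eventually_elim (use k in \<open>auto simp: indicator_def\<close>)
      then show "(\<lambda>n. indicator {x. real (Suc n) \<le> N x} x * v x) \<longlonglongrightarrow> 0"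
        by (rule tendsto_eventually)
    qed
    show "AE x in lborel. norm (indicator {x. real (Suc n) \<le> N x} x * v x)
        \<le> indicator (outside_ball N) x * v x" for n
      using v_nonneg outside_ball_nonzero[OF norm]
      by (intro AE_I2) (auto simp: indicator_def outside_ball_def)
  qed measurable
  then show ?thesis by simp
qed

lemma index_exists:
  obtains \<alpha> where "0 < \<alpha>" "\<And>l. 1 \<le> l \<Longrightarrow> v (l *\<^sub>R 1) = l powr (- \<alpha> - real CARD('n))"
proof -
  \<comment> \<open>The fraction of \<open>mass\<close> at level \<open>l\<close> or beyond, by
    \<open>tail_mass\<close>.\<close>
  define m where "m l = l ^ CARD('n) * v (l *\<^sub>R 1)" for l
  have mass_m: "(LINT x|lborel. indicator {x. l \<le> N x} x * v x) = m l * mass" if "1 \<le> l" for l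
    using tail_mass[of l] that by (simp add: m_def)
  obtain \<alpha> where \<alpha>: "0 \<le> \<alpha>" "\<And>l. 1 \<le> l \<Longrightarrow> m l = l powr (- \<alpha>)"
  proof (rule multiplicative_le_1_imp_powr[of m])
    fix r s :: real assume "1 \<le> r" "1 \<le> s"
    then show "m (r * s) = m r * m s"
      using v_scaleR[of r "s *\<^sub>R 1"] by (simp add: m_def power_mult_distrib)
  next
    fix s :: real assume s: "1 \<le> s"
    show "0 < m s" using s v_diagonal_pos[of s] by (simp add: m_def)
    have "m s * mass \<le> mass"
      unfolding mass_m[OF s, symmetric]
      using s v_nonneg outside_ball_nonzero[OF norm]
      by (intro integral_mono tail_integrable integrable_v) (auto simp: indicator_def outside_ball_def)
    then show "m s \<le> 1" using mass_pos by simp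
  qed blast
  \<comment> \<open>For a zero exponent \<open>m\<close> would be constantly 1, so the tail mass
    would stay at \<open>mass\<close> instead of tending to 0.\<close>
  have "\<alpha> \<noteq> 0"
  proof
    assume "\<alpha> = 0"
    then have "(LINT x|lborel. indicator {x. real (Suc n) \<le> N x} x * v x) = mass" for n
      using mass_m[of "real (Suc n)"] \<alpha>(2)[of "real (Suc n)"] by simp
    then have "(\<lambda>n. mass) \<longlonglongrightarrow> 0"
      using tail_mass_tendsto_0 by simp
    then show False using mass_pos by (simp add: LIMSEQ_const_iff)
  qed
  moreover have "v (l *\<^sub>R 1) = l powr (- \<alpha> - real CARD('n))" if "1 \<le> l" for l
    using \<alpha>(2)[OF that] that by (simp add: m_def powr_diff powr_realpow field_simps)
  ultimately show thesis using \<alpha>(1) by (intro that[of \<alpha>]) auto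
qed

end

text \<open>Lebesgue measure is the completion of \<open>lborel\<close>: a function measurable for
  the completion has a Borel version, and integrability passes to it.\<close>

lemma lebesgue_integrable_imp_lborel_AE_eq:
  fixes g :: "'a::euclidean_space \<Rightarrow> real"
  assumes "integrable lebesgue g"
  obtains w where "integrable lborel w" "AE x in lborel. g x = w x"
proof -
  obtain w where w: "w \<in> borel_measurable lborel" "AE x in lborel. g x = w x"
    using completion_ex_borel_measurable_real[OF borel_measurable_integrable[OF assms]] by auto
  have "integrable lebesgue w"
    using assms w by (subst integrable_cong_AE[where g = g])
      (auto intro: AE_completion measurable_completion simp: eq_commute)
  with w show thesis by (intro that[of w]) (auto simp: integrable_completion)
qed

section \<open>Limits of the conditional densities and laws\<close>

theorem mainTheorem7:
  fixes N :: "real ^ 'n \<Rightarrow> real"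
    and M :: "'w measure"
    and X :: "'w \<Rightarrow> real ^ 'n"
    and f v f\<^sub>Y :: "real ^ 'n \<Rightarrow> real"
  defines "f\<^sub>Y \<equiv> (\<lambda>x. v x / (LINT u:outside_ball N|lborel. v u))"
  assumes "is_norm N"
    and "prob_space M"
    and "\<And>x. 0 \<le> f x"
    and "distributed M lborel X (\<lambda>x. ennreal (f x))"
    and "regularly_varying_density f v"
    and "\<not> (AE x in lborel. x \<in> outside_ball N \<longrightarrow> v x = 0)"
    and "\<exists>g. set_integrable lebesgue (outside_ball N) g \<and>
           (\<forall>\<^sub>F t in at_top. \<forall>x\<in>outside_ball N. \<bar>f (t *\<^sub>R x) / f (t *\<^sub>R 1)\<bar> \<le> g x)"
  shows "(\<forall>\<^sub>F t in at_top.
            distributed (uniform_measure M (exceedance M X N t)) lborel (\<lambda>\<omega>. X \<omega> /\<^sub>R t)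
              (\<lambda>x. ennreal (conditional_density M X f N t x))) \<and>
         (\<forall>x\<in>outside_ball N. ((\<lambda>t. conditional_density M X f N t x) \<longlongrightarrow> f\<^sub>Y x) at_top) \<and>
         prob_density_on (outside_ball N) f\<^sub>Y \<and>
         regularly_varying M X N (law_of_density_on (outside_ball N) f\<^sub>Y) \<and>
         (\<exists>\<alpha>>0. \<forall>l\<ge>1. \<forall>x\<in>outside_ball N.
            f\<^sub>Y (l *\<^sub>R x) = l powr (- \<alpha> - real CARD('n)) * f\<^sub>Y x)"
proof -
  interpret prob_space M by fact
  let ?C = "outside_ball N" and ?\<nu> = "law_of_density_on (outside_ball N) f\<^sub>Y"
  have f_borel: "f \<in> borel_measurable borel"
    using assms(4,5) by (intro measurable_of_ennreal) (auto simp: distributed_def)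
  obtain g where g: "set_integrable lebesgue ?C g"
    "\<forall>\<^sub>F t in at_top. \<forall>x\<in>?C. \<bar>f (t *\<^sub>R x) / f (t *\<^sub>R 1)\<bar> \<le> g x"
    using assms(8) by auto
  obtain w where w: "integrable lborel w" "AE x in lborel. indicator ?C x * g x = w x"
    using lebesgue_integrable_imp_lborel_AE_eq[OF g(1)[unfolded set_integrable_def]] by auto
  \<comment> \<open>Replacing the dominating function by its Borel version weakens the pointwise
    bound to an almost everywhere one, the form the locale expects.\<close>
  have dom: "\<forall>\<^sub>F t in at_top. AE x in lborel.
      \<bar>indicator ?C x * (f (t *\<^sub>R x) / f (t *\<^sub>R 1))\<bar> \<le> w x"
    using g(2)
  proof eventually_elim
    case (elim t)
    show ?case using w(2)
      by eventually_elim (use elim in \<open>auto simp: indicator_def split: if_splits\<close>)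
  qed
  interpret dominated_density N f v w
    using assms(2,4,6,7) f_borel w(1) dom by unfold_locales auto
  have f\<^sub>Y: "f\<^sub>Y = (\<lambda>x. v x / mass)"
    unfolding f\<^sub>Y_def set_lebesgue_integral_def by simp
  have [measurable]: "f\<^sub>Y \<in> borel_measurable borel" unfolding f\<^sub>Y by measurable
  have [measurable]: "X \<in> borel_measurable M" using assms(5) by (auto simp: distributed_def)
  have f\<^sub>Y_nonneg: "0 \<le> f\<^sub>Y x" if "x \<in> ?C" for x
    using v_nonneg[OF outside_ball_nonzero[OF norm that]] mass_pos by (simp add: f\<^sub>Y)

  \<comment> \<open>The tail probability divided by \<open>t ^ CARD('n) * f (t *\<^sub>R 1)\<close>.
    Its positive limit \<open>mass\<close> makes the conditioning event eventually non-null.\<close>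
  define R where "R t = (LINT x|lborel. indicator ?C x * (f (t *\<^sub>R x) / f (t *\<^sub>R 1)))" for t
  have R_lim: "(R \<longlongrightarrow> mass) at_top"
    using integral_ratio_tendsto[of "\<lambda>_. 1" 1] 
    unfolding R_def[abs_def] by (simp del: times_divide_eq_right)
  have P: "measure M (exceedance M X N t) = t ^ CARD('n) * f (t *\<^sub>R 1) * R t" if t: "0 < t" for t
  proof -
    have "(LINT x|lborel. indicator ?C x * f (t *\<^sub>R x)) =
        (LINT x|lborel. f (t *\<^sub>R 1) * (indicator ?C x * (f (t *\<^sub>R x) / f (t *\<^sub>R 1))))"
      using f_diagonal_pos[OF t] by simp
    also have "\<dots> = f (t *\<^sub>R 1) * R t"
      unfolding R_def by (rule integral_mult_right_zero)
    finally show ?thesis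
      using measure_exceedance[OF norm assms(3,4,5) t] by simp
  qed
  have R_pos: "\<forall>\<^sub>F t in at_top. 0 < t \<and> 0 < R t"
    using order_tendstoD(1)[OF R_lim mass_pos] eventually_gt_at_top[of 0]
    by eventually_elim simp
  have P_pos: "0 < measure M (exceedance M X N t)" if "0 < t" "0 < R t" for t
    using P[of t] f_diagonal_pos[of t] that by simp
  \<comment> \<open>The powers of \<open>t\<close> cancel, which leaves ratios with known
    limits.\<close>
  have cond: "conditional_density M X f N t x = indicator ?C x * (f (t *\<^sub>R x) / f (t *\<^sub>R 1)) / R t"
    if "0 < t" for t x
    using P[of t] that by (simp add: conditional_density_def indicator_def)

  have dist: "\<forall>\<^sub>F t in at_top.
      distributed (uniform_measure M (exceedance M X N t)) lborel (\<lambda>\<omega>. X \<omega> /\<^sub>R t)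
        (\<lambda>x. ennreal (conditional_density M X f N t x))"
    using R_pos
    by eventually_elim
      (use distributed_conditional_density[OF norm assms(3,4,5)] P_pos in blast)

  have pointwise: "((\<lambda>t. conditional_density M X f N t x) \<longlongrightarrow> f\<^sub>Y x) at_top" if x: "x \<in> ?C" for x
  proof -
    have "((\<lambda>t. f (t *\<^sub>R x) / f (t *\<^sub>R 1) / R t) \<longlongrightarrow> f\<^sub>Y x) at_top"
      unfolding f\<^sub>Y using mass_pos outside_ball_nonzero[OF norm x]
      by (intro tendsto_divide ratio_tendsto R_lim) auto
    moreover have "\<forall>\<^sub>F t in at_top. f (t *\<^sub>R x) / f (t *\<^sub>R 1) / R t = conditional_density M X f N t x"
      using eventually_gt_at_top[of 0] by eventually_elim (use x in \<open>simp add: cond\<close>)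
    ultimately show ?thesis by (rule Lim_transform_eventually)
  qed

  have nn1: "(\<integral>\<^sup>+x. ennreal (f\<^sub>Y x) * indicator ?C x \<partial>lborel) = 1"
  proof -
    have "(\<integral>\<^sup>+x. ennreal (f\<^sub>Y x) * indicator ?C x \<partial>lborel) =
        (\<integral>\<^sup>+x. ennreal (indicator ?C x * v x / mass) \<partial>lborel)"
      by (intro nn_integral_cong) (auto simp: f\<^sub>Y indicator_def)
    also have "\<dots> = ennreal (LINT x|lborel. indicator ?C x * v x / mass)"
      using integrable_v v_nonneg_outside mass_pos
      by (intro nn_integral_eq_integral) auto
    finally show ?thesis using mass_pos by simp
  qed
  have density: "prob_density_on ?C f\<^sub>Y"
    unfolding prob_density_on_def set_borel_measurable_def using f\<^sub>Y_nonneg nn1 by auto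

  obtain \<alpha> where \<alpha>: "0 < \<alpha>" "\<And>l. 1 \<le> l \<Longrightarrow> v (l *\<^sub>R 1) = l powr (- \<alpha> - real CARD('n))"
    using index_exists by blast
  \<comment> \<open>The index found on the diagonal transfers to every direction by
    \<open>v_scaleR\<close>.\<close>
  have homogeneous: "f\<^sub>Y (l *\<^sub>R x) = l powr (- \<alpha> - real CARD('n)) * f\<^sub>Y x"
    if "1 \<le> l" "x \<in> ?C" for l x
    using that outside_ball_nonzero[OF norm, of x] v_scaleR[of l x] by (simp add: f\<^sub>Y \<alpha>(2))

  have sets_\<nu>[simp, measurable_cong]: "sets ?\<nu> = sets borel" "space ?\<nu> = UNIV"
    by (auto simp: law_of_density_on_def)
  have emeasure_\<nu>: "emeasure ?\<nu> A = (\<integral>\<^sup>+x. ennreal (f\<^sub>Y x) * indicator ?C x * indicator A x \<partial>lborel)"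
    if "A \<in> sets borel" for A
    using that by (simp add: law_of_density_on_def emeasure_density)
  interpret \<nu>: prob_space ?\<nu>
    by (rule prob_spaceI) (simp add: emeasure_\<nu> nn1)
  have \<nu>_C: "measure ?\<nu> ?C = 1"
  proof -
    have "emeasure ?\<nu> ?C = (\<integral>\<^sup>+x. ennreal (f\<^sub>Y x) * indicator ?C x \<partial>lborel)"
      unfolding emeasure_\<nu>[OF C_borel] by (intro nn_integral_cong) (auto simp: indicator_def)
    then show ?thesis using nn1 by (simp add: measure_def)
  qed
  \<comment> \<open>The witness 2 is arbitrary: by \<open>tail_mass\<close> the limit gives the set
    at level \<open>l > 1\<close> the mass \<open>l ^ CARD('n) * v (l *\<^sub>R 1)\<close>, which is
    positive.\<close>
  have \<nu>_2C: "0 < measure ?\<nu> ((\<lambda>x. 2 *\<^sub>R x) ` ?C)"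
  proof -
    have "emeasure ?\<nu> {x. 2 \<le> N x} =
        (\<integral>\<^sup>+x. ennreal (indicator {x. 2 \<le> N x} x * v x / mass) \<partial>lborel)"
      by (subst emeasure_\<nu>)
        (auto intro!: nn_integral_cong simp: f\<^sub>Y indicator_def outside_ball_def)
    also have "\<dots> = ennreal (LINT x|lborel. indicator {x. 2 \<le> N x} x * v x / mass)"
      using tail_integrable[of 2] mass_pos v_nonneg outside_ball_nonzero[OF norm]
      by (intro nn_integral_eq_integral) (auto simp: indicator_def outside_ball_def)
    also have "\<dots> = ennreal (2 ^ CARD('n) * v (2 *\<^sub>R 1))"
      using tail_mass[of 2] mass_pos by simp
    finally have "0 < measure ?\<nu> {x. 2 \<le> N x}"
      using v_diagonal_pos[of 2] by (simp add: measure_def)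
    then show ?thesis using scaleR_image_outside_ball[OF norm, of 2] by simp
  qed

  have weak: "weak_conv_on ?C (conditional_law M X N) ?\<nu> at_top"
    unfolding weak_conv_on_def
  proof (intro allI impI, elim conjE)
    fix h :: "real ^ 'n \<Rightarrow> real"
    assume h: "continuous_on ?C h" "bounded (h ` ?C)"
    obtain B where B: "\<And>x. x \<in> ?C \<Longrightarrow> \<bar>h x\<bar> \<le> B"
      using h(2) by (auto simp: bounded_iff)
    \<comment> \<open>Continuity holds only on the closed set, so \<open>h\<close> is cut off by the
      indicator before measurability is claimed.\<close>
    have h_borel[measurable]: "(\<lambda>x. indicator ?C x * h x) \<in> borel_measurable borel"
      using borel_measurable_continuous_on_indicator[OF C_borel h(1)] by simp
    have lim: "((\<lambda>t. (LINT x|lborel. indicator ?C x * h x * (f (t *\<^sub>R x) / f (t *\<^sub>R 1))) / R t)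
        \<longlongrightarrow> (LINT x|lborel. indicator ?C x * h x * v x) / mass) at_top"
      using mass_pos by (intro tendsto_divide integral_ratio_tendsto[OF h_borel B] R_lim) auto
    have eq: "\<forall>\<^sub>F t in at_top.
        (LINT x|lborel. indicator ?C x * h x * (f (t *\<^sub>R x) / f (t *\<^sub>R 1))) / R t =
        (LINT x:?C|conditional_law M X N t. h x)"
      using R_pos dist
    proof eventually_elim
      case (elim t)
      \<comment> \<open>The law is pushed to \<open>borel\<close> in one definition and to
        \<open>lborel\<close> in the other; only the sigma-algebra of the target enters
        \<open>distr\<close>, and it is the same.\<close>
      have "conditional_law M X N t =
          density lborel (\<lambda>x. ennreal (conditional_density M X f N t x))"
        using elim(2) unfolding conditional_law_def distributed_def
        by (metis distr_cong sets_lborel)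
      then have "(LINT x:?C|conditional_law M X N t. h x) =
          (LINT x|lborel. conditional_density M X f N t x * (indicator ?C x * h x))"
        using conditional_density_nonneg[of f t M X N, OF f_nonneg] elim
          conditional_density_measurable[OF norm f_borel, of M X t]
        by (simp add: set_lebesgue_integral_def integral_density)
      also have "(\<lambda>x. conditional_density M X f N t x * (indicator ?C x * h x)) =
          (\<lambda>x. indicator ?C x * h x * (f (t *\<^sub>R x) / f (t *\<^sub>R 1)) / R t)"
        using elim by (auto simp: cond fun_eq_iff indicator_def)
      finally show ?case by simp
    qed
    have lim_eq: "(LINT x|lborel. indicator ?C x * h x * v x) / mass = (LINT x:?C|?\<nu>. h x)"
    proof -
      \<comment> \<open>Moving the indicator inside \<open>ennreal\<close> gives a real-valued
        density, as \<open>integral_density\<close> requires.\<close>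
      have \<nu>_density: "?\<nu> = density lborel (\<lambda>x. ennreal (f\<^sub>Y x * indicator ?C x))"
        unfolding law_of_density_on_def by (intro arg_cong[where f = "density lborel"])
          (auto simp: indicator_def)
      have "AE x in lborel. 0 \<le> f\<^sub>Y x * indicator ?C x"
        using f\<^sub>Y_nonneg by (intro AE_I2) (auto simp: indicator_def)
      then have "(LINT x:?C|?\<nu>. h x) =
          (LINT x|lborel. f\<^sub>Y x * indicator ?C x * (indicator ?C x * h x))"
        unfolding set_lebesgue_integral_def \<nu>_density by (subst integral_density) simp_all
      also have "(\<lambda>x. f\<^sub>Y x * indicator ?C x * (indicator ?C x * h x)) =
          (\<lambda>x. indicator ?C x * h x * v x / mass)"
        by (auto simp: f\<^sub>Y fun_eq_iff indicator_def)
      finally show ?thesis by simp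
    qed
    show "((\<lambda>t. LINT x:?C|conditional_law M X N t. h x) \<longlongrightarrow> (LINT x:?C|?\<nu>. h x)) at_top"
      using Lim_transform_eventually[OF lim eq] unfolding lim_eq .
  qed

  have "regularly_varying M X N ?\<nu>"
    unfolding regularly_varying_def
    using \<nu>_C weak \<nu>.prob_space_axioms \<nu>_2C by (auto intro!: exI[of _ "2::real"])
  then show ?thesis
    using dist pointwise density homogeneous \<alpha>(1) by blast
qed

end
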